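(* Let $A_s\in\mathbb C^{n\times n}$ be diagonal with $\dim\mathcal C^{\rm for}(A_s)<\infty$. Then $$\mathcal N^{\rm for}(f)=\mathcal C^{\rm for}(f)+\{\beta f;\ \beta\in\mathbb C[[x_1,\ldots,x_n]]\}$$ for any formal vector field $f=A+\cdots$ in Poincaré–Dulac normal form whose linear part $A$ has semisimple part $A_s$.
   Context: Formal vector fields on $\mathbb C^n$ are elements of $\mathbb C[[x_1,\ldots,x_n]]^n$; a matrix $B$ is identified with the linear vector field $x\mapsto Bx$. $[g,h](x)=Dh(x)g(x)-Dg(x)h(x)$. $$\mathcal C^{\rm for}(f)=\{g\in\mathbb C[[x_1,\ldots,x_n]]^n;\ [g,f]=0\},$$ $$\mathcal N^{\rm for}(f)=\{g\in\mathbb C[[x_1,\ldots,x_n]]^n;\ [g,f]=\lambda f\text{ for some }\lambda\in\mathbb C[[x_1,\ldots,x_n]]\};$$ dimension is over $\mathbb C$. $f(x)=Ax+\text{(terms of degree}\ge2)$ is in Poincaré–Dulac normal form if $[A_s,f]=0$, with $A_s$ the semisimple part of $A$ in its Jordan–Chevalley decomposition. *)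

theory Defs
  imports "HOL-Analysis.Analysis" "HOL-Library.Set_Algebras"
begin

section \<open>Formal power series in finitely many variables\<close>

text \<open>
  The index type \<open>'n\<close> names the variables, so \<open>n = CARD('n)\<close>. A multi-index is a function
  \<open>'n \<Rightarrow> nat\<close>, and a series is its family of coefficients.
\<close>

typedef 'n mfps = "UNIV :: (('n \<Rightarrow> nat) \<Rightarrow> complex) set"
  morphisms mfps_nth Abs_mfps ..

setup_lifting type_definition_mfps

lemma mfps_eqI: "(\<And>m. mfps_nth f m = mfps_nth g m) \<Longrightarrow> f = g"
  by (metis ext mfps_nth_inject)

lemma finite_multiindex_le [simp]:
  fixes m :: "'n::finite \<Rightarrow> nat"
  shows "finite {a. a \<le> m}"
proof -
  have "{a. a \<le> m} = PiE UNIV (\<lambda>i. {..m i})"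
    by (auto simp: le_fun_def PiE_UNIV_domain)
  then show ?thesis
    by (simp add: finite_PiE)
qed

instantiation mfps :: (finite) comm_ring_1
begin

lift_definition zero_mfps :: "'a mfps" is "\<lambda>m. 0" .

lift_definition one_mfps :: "'a mfps" is "\<lambda>m. if m = (\<lambda>i. 0) then 1 else 0" .

lift_definition plus_mfps :: "'a mfps \<Rightarrow> 'a mfps \<Rightarrow> 'a mfps" is "\<lambda>f g m. f m + g m" .

lift_definition uminus_mfps :: "'a mfps \<Rightarrow> 'a mfps" is "\<lambda>f m. - f m" .

lift_definition minus_mfps :: "'a mfps \<Rightarrow> 'a mfps \<Rightarrow> 'a mfps" is "\<lambda>f g m. f m - g m" .

lift_definition times_mfps :: "'a mfps \<Rightarrow> 'a mfps \<Rightarrow> 'a mfps"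
  is "\<lambda>f g m. \<Sum>a | a \<le> m. f a * g (\<lambda>i. m i - a i)" .

instance
proof
  fix f g h :: "'a mfps"
  show "f * g * h = f * (g * h)"
  proof transfer
    fix f g h :: "('a \<Rightarrow> nat) \<Rightarrow> complex"
    show "(\<lambda>m. \<Sum>c | c \<le> m. (\<Sum>a | a \<le> c. f a * g (\<lambda>i. c i - a i)) * h (\<lambda>i. m i - c i)) =
      (\<lambda>m. \<Sum>a | a \<le> m. f a *
        (\<Sum>b | b \<le> (\<lambda>i. m i - a i). g b * h (\<lambda>i. m i - a i - b i)))"
    proof
      fix m :: "'a \<Rightarrow> nat"
      have "(\<Sum>c | c \<le> m. (\<Sum>a | a \<le> c. f a * g (\<lambda>i. c i - a i)) * h (\<lambda>i. m i - c i)) =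
        (\<Sum>(c, a) \<in> Sigma {c. c \<le> m} (\<lambda>c. {a. a \<le> c}).
          f a * g (\<lambda>i. c i - a i) * h (\<lambda>i. m i - c i))"
        by (simp add: sum_distrib_right sum.Sigma)
      also have "\<dots> = (\<Sum>(a, b) \<in> Sigma {a. a \<le> m} (\<lambda>a. {b. b \<le> (\<lambda>i. m i - a i)}).
          f a * (g b * h (\<lambda>i. m i - a i - b i)))"
      proof (rule sum.reindex_bij_witness
          [where i = "\<lambda>(a, b). ((\<lambda>i. a i + b i), a)" and j = "\<lambda>(c, a). (a, \<lambda>i. c i - a i)"],
          goal_cases)
        case (1 p)
        then show ?case by (auto simp: le_fun_def)
      next
        case (2 p)
        then show ?case by (auto simp: le_fun_def intro: order_trans diff_le_mono)
      next
        case (3 p)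
        then show ?case by (auto simp: le_fun_def)
      next
        case (4 p)
        then obtain a b where p: "p = (a, b)" and ab: "\<forall>i. a i \<le> m i" "\<forall>i. b i \<le> m i - a i"
          by (auto simp: le_fun_def)
        then have "a i + b i \<le> m i" for i
          by (metis Nat.le_diff_conv2 add.commute)
        then show ?case
          by (auto simp: p le_fun_def)
      next
        case (5 p)
        then show ?case by (auto simp: le_fun_def mult.assoc)
      qed
      also have "\<dots> = (\<Sum>a | a \<le> m. f a *
          (\<Sum>b | b \<le> (\<lambda>i. m i - a i). g b * h (\<lambda>i. m i - a i - b i)))"
        by (simp add: sum_distrib_left sum.Sigma)
      finally show "(\<Sum>c | c \<le> m. (\<Sum>a | a \<le> c. f a * g (\<lambda>i. c i - a i)) * h (\<lambda>i. m i - c i)) =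
        (\<Sum>a | a \<le> m. f a *
          (\<Sum>b | b \<le> (\<lambda>i. m i - a i). g b * h (\<lambda>i. m i - a i - b i)))" .
    qed
  qed
  show "f * g = g * f"
  proof transfer
    fix f g :: "('a \<Rightarrow> nat) \<Rightarrow> complex"
    show "(\<lambda>m. \<Sum>a | a \<le> m. f a * g (\<lambda>i. m i - a i)) =
      (\<lambda>m. \<Sum>a | a \<le> m. g a * f (\<lambda>i. m i - a i))"
    proof
      fix m :: "'a \<Rightarrow> nat"
      show "(\<Sum>a | a \<le> m. f a * g (\<lambda>i. m i - a i)) =
        (\<Sum>a | a \<le> m. g a * f (\<lambda>i. m i - a i))"
        by (rule sum.reindex_bij_witness
            [where i = "\<lambda>a i. m i - a i" and j = "\<lambda>a i. m i - a i"])
          (auto simp: le_fun_def)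
    qed
  qed
  show "1 * f = f"
  proof transfer
    fix f :: "('a \<Rightarrow> nat) \<Rightarrow> complex"
    show "(\<lambda>m. \<Sum>a | a \<le> m. (if a = (\<lambda>i. 0) then 1 else 0) * f (\<lambda>i. m i - a i)) = f"
    proof
      fix m :: "'a \<Rightarrow> nat"
      have "(\<Sum>a | a \<le> m. (if a = (\<lambda>i. 0) then 1 else 0) * f (\<lambda>i. m i - a i)) =
        (\<Sum>a | a \<le> m. if a = (\<lambda>i. 0) then f m else 0)"
        by (rule sum.cong) auto
      also have "\<dots> = f m"
        by (subst sum.delta [OF finite_multiindex_le]) (simp add: le_fun_def)
      finally show "(\<Sum>a | a \<le> m. (if a = (\<lambda>i. 0) then 1 else 0) * f (\<lambda>i. m i - a i)) = f m" .
    qed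
  qed
  show "(f + g) * h = f * h + g * h"
    by transfer (simp add: algebra_simps sum.distrib)
  show "(0 :: 'a mfps) \<noteq> 1"
    by transfer (auto simp: fun_eq_iff)
qed (transfer; simp add: algebra_simps fun_eq_iff)+

end

lift_definition mfps_const :: "complex \<Rightarrow> 'n mfps" is "\<lambda>c m. if m = (\<lambda>i. 0) then c else 0" .

definition unit_index :: "'n \<Rightarrow> 'n \<Rightarrow> nat" where
  "unit_index i = (\<lambda>j. if j = i then 1 else 0)"

lift_definition mfps_X :: "'n \<Rightarrow> 'n mfps" is "\<lambda>i m. if m = unit_index i then 1 else 0" .

text \<open>The formal partial derivative with respect to the \<open>i\<close>-th variable.\<close>

lift_definition mfps_deriv :: "'n \<Rightarrow> 'n mfps \<Rightarrow> 'n mfps"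
  is "\<lambda>i f m. of_nat (m i + 1) * f (m(i := m i + 1))" .

lemma mfps_const_add: "mfps_const (c + d) = mfps_const c + (mfps_const d :: 'n::finite mfps)"
  by transfer auto

lemma mfps_nth_const_mult:
  fixes f :: "'n::finite mfps"
  shows "mfps_nth (mfps_const c * f) m = c * mfps_nth f m"
proof transfer
  fix c and f :: "('n \<Rightarrow> nat) \<Rightarrow> complex" and m :: "'n \<Rightarrow> nat"
  have "(\<Sum>a | a \<le> m. (if a = (\<lambda>i. 0) then c else 0) * f (\<lambda>i. m i - a i)) =
    (\<Sum>a | a \<le> m. if a = (\<lambda>i. 0) then c * f m else 0)"
    by (rule sum.cong) auto
  also have "\<dots> = c * f m"
    by (subst sum.delta [OF finite_multiindex_le]) (simp add: le_fun_def)
  finally show "(\<Sum>a | a \<le> m. (if a = (\<lambda>i. 0) then c else 0) * f (\<lambda>i. m i - a i)) = c * f m" .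
qed

lemma mfps_const_mult: "mfps_const (c * d) = mfps_const c * (mfps_const d :: 'n::finite mfps)"
  by (rule mfps_eqI, simp only: mfps_nth_const_mult, transfer) simp

lemma mfps_const_1: "mfps_const 1 = (1 :: 'n::finite mfps)"
  by transfer simp


section \<open>Formal vector fields\<close>

type_synonym 'n vfield = "('n mfps) ^ 'n"

definition vf_scale :: "complex \<Rightarrow> 'n::finite vfield \<Rightarrow> 'n vfield" where
  "vf_scale c g = mfps_const c *s g"

interpretation vf: vector_space "vf_scale :: complex \<Rightarrow> 'n::finite vfield \<Rightarrow> 'n vfield"
  by unfold_locales
    (simp_all add: vf_scale_def vec_eq_iff algebra_simps mfps_const_add mfps_const_mult mfps_const_1)

definition vf_finite_dim :: "'n::finite vfield set \<Rightarrow> bool" where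
  "vf_finite_dim V \<longleftrightarrow> (\<exists>B. finite B \<and> V = vf.span B)"

definition linear_vf :: "complex ^ 'n ^ 'n \<Rightarrow> 'n::finite vfield" where
  "linear_vf B = (\<chi> i j. mfps_const (B $ i $ j)) *v (\<chi> j. mfps_X j)"

definition jacobian :: "'n::finite vfield \<Rightarrow> ('n mfps) ^ 'n ^ 'n" where
  "jacobian h = (\<chi> i j. mfps_deriv j (h $ i))"

definition lie_bracket :: "'n::finite vfield \<Rightarrow> 'n vfield \<Rightarrow> 'n vfield" where
  "lie_bracket g h = jacobian h *v g - jacobian g *v h"

definition centralizer_for :: "'n::finite vfield \<Rightarrow> 'n vfield set" where
  "centralizer_for f = {g. lie_bracket g f = 0}"

definition normalizer_for :: "'n::finite vfield \<Rightarrow> 'n vfield set" where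
  "normalizer_for f = {g. \<exists>\<mu> :: 'n mfps. lie_bracket g f = \<mu> *s f}"


section \<open>Jordan--Chevalley decomposition and Poincare--Dulac normal form\<close>

definition diagonal :: "complex ^ 'n ^ 'n \<Rightarrow> bool" where
  "diagonal D \<longleftrightarrow> (\<forall>i j. i \<noteq> j \<longrightarrow> D $ i $ j = 0)"

text \<open>Over the complex numbers, semisimple means diagonalizable.\<close>

definition semisimple :: "complex ^ 'n ^ 'n::finite \<Rightarrow> bool" where
  "semisimple S \<longleftrightarrow>
    (\<exists>P D :: complex ^ 'n ^ 'n. invertible P \<and> diagonal D \<and> S = P ** D ** matrix_inv P)"

text \<open>
  Powers are iterated \<open>(**)\<close>: the library's \<open>(^)\<close> on \<open>complex ^ 'n ^ 'n\<close> is componentwise.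
\<close>

definition nilpotent :: "complex ^ 'n ^ 'n::finite \<Rightarrow> bool" where
  "nilpotent N \<longleftrightarrow> (\<exists>k. (((**) N) ^^ k) (mat 1) = 0)"

text \<open>\<open>S\<close> is the semisimple part of \<open>A\<close> in its (unique) Jordan--Chevalley decomposition.\<close>

definition is_semisimple_part :: "complex ^ 'n ^ 'n \<Rightarrow> complex ^ 'n ^ 'n::finite \<Rightarrow> bool" where
  "is_semisimple_part A S \<longleftrightarrow>
    (\<exists>N. A = S + N \<and> semisimple S \<and> nilpotent N \<and> S ** N = N ** S)"

definition has_linear_part :: "'n::finite vfield \<Rightarrow> complex ^ 'n ^ 'n \<Rightarrow> bool" where
  "has_linear_part f A \<longleftrightarrow>
    (\<forall>i. mfps_nth (f $ i) (\<lambda>_. 0) = 0) \<and>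
    (\<forall>i j. mfps_nth (f $ i) (unit_index j) = A $ i $ j)"

definition poincare_dulac_normal_form :: "'n::finite vfield \<Rightarrow> bool" where
  "poincare_dulac_normal_form f \<longleftrightarrow>
    (\<exists>A S. has_linear_part f A \<and> is_semisimple_part A S \<and> lie_bracket (linear_vf S) f = 0)"

end

theory Submission
  imports Defs
begin

text \<open>
  Let \<open>L\<close> be the derivation along \<open>f\<close>. Since \<open>[\<beta>f, f] = - L(\<beta>) f\<close>, a field \<open>g\<close> with
  \<open>[g, f] = \<mu>f\<close> splits as required once \<open>L(\<beta>) = - \<mu>\<close> is solvable. Finite dimension excludes
  nonconstant monomial first integrals of \<open>A\<^sub>s\<close>, so the derivation along \<open>A\<^sub>s\<close> is invertible on
  homogeneous polynomials of each positive degree; that along the nilpotent part of \<open>A\<close> commutes with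
  it and is locally nilpotent. Hence \<open>L\<close> maps onto the series without constant term. To see
  \<open>\<mu>(0) = 0\<close>: \<open>A\<close> is invertible, so \<open>[g, f] = \<mu>f\<close> gives \<open>g(0) = 0\<close> in degree \<open>0\<close> and
  \<open>AB - BA = \<mu>(0) A\<close> in degree \<open>1\<close>; multiply by the inverse of \<open>A\<close> and take traces.
\<close>

section \<open>Coefficients of products and derivatives\<close>

lemma mfps_nth_add [simp]: "mfps_nth (p + q :: 'n::finite mfps) m = mfps_nth p m + mfps_nth q m"
  by transfer simp

lemma mfps_nth_diff [simp]: "mfps_nth (p - q :: 'n::finite mfps) m = mfps_nth p m - mfps_nth q m"
  by transfer simp

lemma mfps_nth_uminus [simp]: "mfps_nth (- p :: 'n::finite mfps) m = - mfps_nth p m"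
  by transfer simp

lemma mfps_nth_0 [simp]: "mfps_nth (0 :: 'n::finite mfps) m = 0"
  by transfer simp

lemma mfps_nth_sum [simp]:
  "mfps_nth (sum p S :: 'n::finite mfps) m = (\<Sum>x\<in>S. mfps_nth (p x) m)"
  by (induction S rule: infinite_finite_induct) auto

lemma mfps_nth_mult:
  "mfps_nth (p * q :: 'n::finite mfps) m = (\<Sum>a | a \<le> m. mfps_nth p a * mfps_nth q (\<lambda>i. m i - a i))"
  by transfer simp

lemma mfps_nth_X: "mfps_nth (mfps_X i) m = (if m = unit_index i then 1 else 0)"
  by transfer simp

lemma mfps_nth_deriv:
  "mfps_nth (mfps_deriv i p) m = of_nat (m i + 1) * mfps_nth p (m(i := m i + 1))"
  by transfer simp

lemma mfps_nth_mult_0: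
  "mfps_nth (p * q :: 'n::finite mfps) (\<lambda>_. 0) = mfps_nth p (\<lambda>_. 0) * mfps_nth q (\<lambda>_. 0)"
proof -
  have "{a. a \<le> (\<lambda>_::'n. 0::nat)} = {\<lambda>_. 0}"
    by (auto simp: le_fun_def)
  then show ?thesis
    by (simp add: mfps_nth_mult)
qed

text \<open>Only two exponents lie below a unit index, so the convolution has two terms. This reads
  off the degree one part of the bracket equation.\<close>

lemma mfps_nth_mult_unit_index:
  "mfps_nth (p * q :: 'n::finite mfps) (unit_index k) =
    mfps_nth p (\<lambda>_. 0) * mfps_nth q (unit_index k) + mfps_nth p (unit_index k) * mfps_nth q (\<lambda>_. 0)"
proof -
  have "a = (\<lambda>_. 0) \<or> a = unit_index k" if "a \<le> unit_index k" for a
  proof (cases "a k = 0")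
    case True
    with that have "a i = 0" for i
      by (cases "i = k") (auto simp: le_fun_def unit_index_def dest: spec[of _ i])
    then show ?thesis by auto
  next
    case False
    have "a i = unit_index k i" for i
      using that[unfolded le_fun_def, rule_format, of i] False
      by (cases "i = k") (auto simp: unit_index_def)
    then show ?thesis by auto
  qed
  then have "{a. a \<le> unit_index k} = {\<lambda>_. 0, unit_index k}"
    by (auto simp: le_fun_def)
  moreover have "(\<lambda>_. 0) \<noteq> unit_index k"
    by (auto simp: unit_index_def fun_eq_iff)
  ultimately show ?thesis
    by (simp add: mfps_nth_mult)
qed

lemma mfps_nth_X_mult:
  "mfps_nth (mfps_X i * p :: 'n::finite mfps) m =
    (if m i = 0 then 0 else mfps_nth p (m(i := m i - 1)))"
proof -
  have "mfps_nth (mfps_X i * p) m =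
      (\<Sum>a | a \<le> m. if a = unit_index i then mfps_nth p (\<lambda>j. m j - unit_index i j) else 0)"
    unfolding mfps_nth_mult mfps_nth_X by (rule sum.cong) auto
  also have "\<dots> = (if unit_index i \<le> m then mfps_nth p (\<lambda>j. m j - unit_index i j) else 0)"
    by (subst sum.delta [OF finite_multiindex_le]) simp
  also have "unit_index i \<le> m \<longleftrightarrow> m i \<noteq> 0"
    by (auto simp: le_fun_def unit_index_def)
  also have "(\<lambda>j. m j - unit_index i j) = m(i := m i - 1)"
    by (auto simp: unit_index_def)
  finally show ?thesis by simp
qed

lemma mfps_deriv_add [simp]:
  "mfps_deriv i (p + q :: 'n::finite mfps) = mfps_deriv i p + mfps_deriv i q"
  by (rule mfps_eqI) (simp add: mfps_nth_deriv algebra_simps)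

lemma mfps_deriv_0 [simp]: "mfps_deriv i (0 :: 'n::finite mfps) = 0"
  by (rule mfps_eqI) (simp add: mfps_nth_deriv)

lemma mfps_deriv_const [simp]: "mfps_deriv i (mfps_const c :: 'n::finite mfps) = 0"
proof (rule mfps_eqI)
  fix m :: "'n \<Rightarrow> nat"
  have "m(i := Suc (m i)) \<noteq> (\<lambda>_. 0)"
    by (metis fun_upd_same nat.distinct(2))
  then show "mfps_nth (mfps_deriv i (mfps_const c)) m = mfps_nth 0 m"
    by (simp add: mfps_nth_deriv mfps_const.rep_eq)
qed

lemma mfps_deriv_X: "mfps_deriv i (mfps_X j) = (if i = j then 1 else 0 :: 'n::finite mfps)"
proof (rule mfps_eqI)
  fix m :: "'n \<Rightarrow> nat"
  have "m(i := Suc (m i)) = unit_index j \<longleftrightarrow> i = j \<and> m = (\<lambda>_. 0)"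
    by (auto simp: fun_eq_iff unit_index_def split: if_splits)
  then show "mfps_nth (mfps_deriv i (mfps_X j)) m =
      mfps_nth (if i = j then 1 else 0 :: 'n mfps) m"
    by (auto simp: mfps_nth_deriv mfps_nth_X one_mfps.rep_eq)
qed

text \<open>The factor \<open>?m i\<close> produced by differentiating splits as
  \<open>a i + (?m i - a i)\<close> inside the convolution; each summand differentiates one of the
  two factors.\<close>

lemma mfps_deriv_mult:
  "mfps_deriv i (p * q :: 'n::finite mfps) = mfps_deriv i p * q + p * mfps_deriv i q"
proof (rule mfps_eqI)
  fix m :: "'n \<Rightarrow> nat"
  let ?m = "m(i := m i + 1)"
  have half: "(\<Sum>a | a \<le> ?m. of_nat (a i) * (mfps_nth r a * mfps_nth s (\<lambda>j. ?m j - a j))) =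
      mfps_nth (mfps_deriv i r * s) m" for r s :: "'n mfps"
  proof -
    \<comment> \<open>Terms with \<open>a i = 0\<close> vanish; on the rest, lowering the exponent
      at \<open>i\<close> is a bijection onto the exponents below \<open>m\<close>.\<close>
    have "(\<Sum>a | a \<le> ?m. of_nat (a i) * (mfps_nth r a * mfps_nth s (\<lambda>j. ?m j - a j))) =
      (\<Sum>a | a \<le> ?m \<and> a i \<noteq> 0. of_nat (a i) * (mfps_nth r a * mfps_nth s (\<lambda>j. ?m j - a j)))"
      by (rule sum.mono_neutral_right) (auto intro: finite_subset[OF _ finite_multiindex_le])
    also have "\<dots> = (\<Sum>a | a \<le> m. mfps_nth (mfps_deriv i r) a * mfps_nth s (\<lambda>j. m j - a j))"
    proof (rule sum.reindex_bij_witness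
        [where i = "\<lambda>a. a(i := a i + 1)" and j = "\<lambda>a. a(i := a i - 1)"], goal_cases)
      case (2 a)
      then show ?case
        by (auto simp: le_fun_def split: if_splits)
    next
      case (5 a)
      then have "(\<lambda>j. m j - (a(i := a i - 1)) j) = (\<lambda>j. ?m j - a j)"
        by (auto simp: fun_eq_iff)
      with 5 show ?case
        by (auto simp: mfps_nth_deriv)
    qed (auto simp: le_fun_def)
    finally show ?thesis
      by (simp add: mfps_nth_mult)
  qed
  have "mfps_nth (mfps_deriv i (p * q)) m =
      (\<Sum>a | a \<le> ?m. of_nat (?m i) * (mfps_nth p a * mfps_nth q (\<lambda>j. ?m j - a j)))"
    by (simp add: mfps_nth_deriv mfps_nth_mult sum_distrib_left)
  also have "\<dots> = (\<Sum>a | a \<le> ?m. of_nat (a i) * (mfps_nth p a * mfps_nth q (\<lambda>j. ?m j - a j))) +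
      (\<Sum>a | a \<le> ?m. of_nat (?m i - a i) * (mfps_nth p a * mfps_nth q (\<lambda>j. ?m j - a j)))"
    unfolding sum.distrib[symmetric] distrib_right[symmetric] of_nat_add[symmetric]
    by (rule sum.cong) (auto simp: le_fun_def dest: spec[of _ i])
  \<comment> \<open>Reflecting \<open>a\<close> to \<open>?m - a\<close> exchanges the factors, so
    \<open>half\<close> applies to this sum too.\<close>
  also have "(\<Sum>a | a \<le> ?m. of_nat (?m i - a i) * (mfps_nth p a * mfps_nth q (\<lambda>j. ?m j - a j))) =
      (\<Sum>a | a \<le> ?m. of_nat (a i) * (mfps_nth q a * mfps_nth p (\<lambda>j. ?m j - a j)))"
    by (rule sum.reindex_bij_witness
        [where i = "\<lambda>a j. ?m j - a j" and j = "\<lambda>a j. ?m j - a j"])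
      (auto simp: le_fun_def)
  finally show "mfps_nth (mfps_deriv i (p * q)) m =
      mfps_nth (mfps_deriv i p * q + p * mfps_deriv i q) m"
    by (simp only: half mfps_nth_add mult.commute[of p])
qed


section \<open>Vector fields as derivations\<close>

definition lie_derivative :: "'n::finite vfield \<Rightarrow> 'n mfps \<Rightarrow> 'n mfps" where
  "lie_derivative g p = (\<Sum>j\<in>UNIV. mfps_deriv j p * g $ j)"

lemma lie_derivative_add: "lie_derivative g (p + q) = lie_derivative g p + lie_derivative g q"
  by (simp add: lie_derivative_def algebra_simps sum.distrib)

lemma lie_derivative_0 [simp]: "lie_derivative g 0 = 0"
  by (simp add: lie_derivative_def)

lemma lie_derivative_mult:
  "lie_derivative g (p * q) = lie_derivative g p * q + p * lie_derivative g q"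
  by (simp add: lie_derivative_def mfps_deriv_mult algebra_simps sum.distrib sum_distrib_left)

lemma lie_derivative_const [simp]: "lie_derivative g (mfps_const c) = 0"
  by (simp add: lie_derivative_def)

lemma lie_derivative_minus: "lie_derivative g (- p) = - lie_derivative g p"
  using lie_derivative_add[of g p "- p"] by (simp add: add_eq_0_iff)

lemma lie_derivative_diff: "lie_derivative g (p - q) = lie_derivative g p - lie_derivative g q"
  using lie_derivative_add[of g p "- q"] by (simp add: lie_derivative_minus)

lemma lie_derivative_sum:
  "lie_derivative g (sum p S) = (\<Sum>x\<in>S. lie_derivative g (p x))"
  by (induction S rule: infinite_finite_induct) (auto simp: lie_derivative_add)

lemma lie_derivative_vf_add: "lie_derivative (g + h) p = lie_derivative g p + lie_derivative h p"
  by (simp add: lie_derivative_def algebra_simps sum.distrib)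

lemma lie_derivative_vf_diff: "lie_derivative (g - h) p = lie_derivative g p - lie_derivative h p"
  by (simp add: lie_derivative_def algebra_simps sum_subtractf)

lemma lie_derivative_scale: "lie_derivative (b *s g) p = b * lie_derivative g p"
  by (simp add: lie_derivative_def algebra_simps sum_distrib_left)

lemma lie_derivative_X [simp]: "lie_derivative g (mfps_X i) = g $ i"
  by (simp add: lie_derivative_def mfps_deriv_X if_distrib[of "\<lambda>x. x * _"] cong: if_cong)

text \<open>The only place where the Jacobian form of the bracket is unfolded; afterwards the
  Leibniz rule for derivations does the work.\<close>

lemma lie_bracket_nth: "lie_bracket g h $ i = lie_derivative g (h $ i) - lie_derivative h (g $ i)"
  by (simp add: lie_bracket_def lie_derivative_def jacobian_def matrix_vector_mult_def)

lemma lie_bracket_diff: "lie_bracket (g - h) f = lie_bracket g f - lie_bracket h f"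
  by (simp add: vec_eq_iff lie_bracket_nth lie_derivative_vf_diff lie_derivative_diff)

lemma lie_bracket_add: "lie_bracket (g + h) f = lie_bracket g f + lie_bracket h f"
  by (simp add: vec_eq_iff lie_bracket_nth lie_derivative_vf_add lie_derivative_add)

text \<open>By the Leibniz rule the two terms in which \<open>b\<close> is not differentiated
  cancel.\<close>

lemma lie_bracket_scale_self: "lie_bracket (b *s f) f = - lie_derivative f b *s f"
  by (simp add: vec_eq_iff lie_bracket_nth lie_derivative_scale lie_derivative_mult)

lemma linear_vf_nth: "linear_vf B $ i = (\<Sum>j\<in>UNIV. mfps_const (B $ i $ j) * mfps_X j)"
  by (simp add: linear_vf_def matrix_vector_mult_def)

lemma linear_vf_add: "linear_vf (B + C) = linear_vf B + linear_vf C"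
  by (simp add: vec_eq_iff linear_vf_nth mfps_const_add algebra_simps sum.distrib)

text \<open>On linear forms the derivation is right multiplication of the coefficient matrix, so its
  iterates become matrix powers.\<close>

lemma lie_derivative_linear_vf_nth:
  "lie_derivative (linear_vf C) (linear_vf B $ i) = linear_vf (B ** C) $ i"
proof -
  have const_sum: "mfps_const (sum c S) = (\<Sum>x\<in>S. mfps_const (c x) :: 'a mfps)"
    for c :: "'a \<Rightarrow> complex" and S
    by (rule mfps_eqI) (simp add: mfps_const.rep_eq)
  have "linear_vf (B ** C) $ i =
      (\<Sum>k\<in>UNIV. \<Sum>j\<in>UNIV. mfps_const (B $ i $ j) * (mfps_const (C $ j $ k) * mfps_X k))"
    unfolding linear_vf_nth
    by (simp add: matrix_matrix_mult_def const_sum mfps_const_mult sum_distrib_right mult.assoc)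
  also have "\<dots> = (\<Sum>j\<in>UNIV. \<Sum>k\<in>UNIV. mfps_const (B $ i $ j) * (mfps_const (C $ j $ k) * mfps_X k))"
    by (rule sum.swap)
  also have "\<dots> = lie_derivative (linear_vf C) (linear_vf B $ i)"
    by (simp add: linear_vf_nth lie_derivative_sum lie_derivative_mult sum_distrib_left)
  finally show ?thesis ..
qed

text \<open>Expands the derivation into the operators \<open>x_k d/dx_j\<close>. The case
  \<open>m k = 0\<close> is separate because \<open>m k - 1\<close> is truncated there.\<close>

lemma lie_derivative_linear_vf_coeff:
  "mfps_nth (lie_derivative (linear_vf B) p) m =
    (\<Sum>j\<in>UNIV. \<Sum>k\<in>UNIV. B $ j $ k *
      (if m k = 0 then 0 else mfps_nth (mfps_deriv j p) (m(k := m k - 1))))"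
proof -
  have "lie_derivative (linear_vf B) p =
      (\<Sum>j\<in>UNIV. \<Sum>k\<in>UNIV. mfps_const (B $ j $ k) * (mfps_X k * mfps_deriv j p))"
    by (simp add: lie_derivative_def linear_vf_nth sum_distrib_left mult_ac)
  then show ?thesis
    by (simp add: mfps_nth_const_mult mfps_nth_X_mult)
qed

text \<open>The eigenvalue of the derivation along the diagonal field on the monomial with exponent
  \<open>m\<close>.\<close>

definition weight :: "complex ^ 'n ^ 'n \<Rightarrow> ('n::finite \<Rightarrow> nat) \<Rightarrow> complex" where
  "weight D m = (\<Sum>j\<in>UNIV. of_nat (m j) * D $ j $ j)"

lemma lie_derivative_diagonal:
  assumes "diagonal D"
  shows "mfps_nth (lie_derivative (linear_vf D) p) m = weight D m * mfps_nth p m"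
proof -
  have "(\<Sum>k\<in>UNIV. D $ j $ k *
      (if m k = 0 then 0 else mfps_nth (mfps_deriv j p) (m(k := m k - 1)))) =
      (\<Sum>k\<in>UNIV. if k = j then of_nat (m j) * D $ j $ j * mfps_nth p m else 0)" for j
    using assms by (intro sum.cong) (auto simp: diagonal_def mfps_nth_deriv)
  then show ?thesis
    by (simp add: lie_derivative_linear_vf_coeff weight_def sum_distrib_right)
qed


section \<open>Resonances\<close>

lift_definition mfps_monom :: "('n \<Rightarrow> nat) \<Rightarrow> 'n mfps" is "\<lambda>m k. if k = m then 1 else 0" .

text \<open>The classical resonance condition: one half of the bracket scales the monomial by
  \<open>D $ i $ i\<close>, the other by its weight.\<close>

lemma monomial_vf_in_centralizer:
  assumes D: "diagonal D" and m: "weight D m = D $ i $ i"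
  shows "(\<chi> j. if j = i then mfps_monom m else 0) \<in> centralizer_for (linear_vf D)"
proof -
  let ?g = "(\<chi> j. if j = i then mfps_monom m else 0) :: 'a vfield"
  have "lie_bracket ?g (linear_vf D) $ k = 0" for k
  proof (rule mfps_eqI)
    fix a
    have "lie_derivative ?g (linear_vf D $ k) = (\<Sum>j\<in>UNIV. mfps_const (D $ k $ j) * ?g $ j)"
      by (simp add: linear_vf_nth lie_derivative_sum lie_derivative_mult)
    also have "\<dots> = (\<Sum>j\<in>UNIV. if j = k then mfps_const (D $ k $ k) * ?g $ k else 0)"
      using D by (intro sum.cong) (auto simp: diagonal_def intro!: mfps_eqI simp: mfps_nth_const_mult)
    finally have "lie_derivative ?g (linear_vf D $ k) = mfps_const (D $ k $ k) * ?g $ k"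
      by simp
    then show "mfps_nth (lie_bracket ?g (linear_vf D) $ k) a = mfps_nth 0 a"
      using m by (auto simp: lie_bracket_nth lie_derivative_diagonal[OF D] mfps_nth_const_mult
          mfps_monom.rep_eq)
  qed
  then show ?thesis
    by (simp add: centralizer_for_def vec_eq_iff)
qed

text \<open>
  If \<open>x\<^sup>m\<close> were a nonconstant first integral of \<open>D\<close>, all \<open>x\<^sup>k\<^sup>m x\<^sub>i e\<^sub>i\<close> would commute with \<open>D\<close>.
\<close>

lemma weight_nonzero:
  fixes D :: "complex ^ 'n ^ 'n::finite"
  assumes D: "diagonal D" and fin: "vf_finite_dim (centralizer_for (linear_vf D))"
    and m: "m \<noteq> (\<lambda>_. 0)"
  shows "weight D m \<noteq> 0"
proof
  assume 0: "weight D m = 0"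
  from m obtain i where i: "m i \<noteq> 0" by auto
  define e where "e k = (\<lambda>j. k * m j + unit_index i j)" for k
  define g :: "nat \<Rightarrow> 'n vfield" where "g k = (\<chi> j. if j = i then mfps_monom (e k) else 0)" for k
  \<comment> \<open>The exponents already differ at \<open>i\<close>, where \<open>m\<close> is
    nonzero.\<close>
  have e_eq: "e k = e l \<longleftrightarrow> k = l" for k l
    using i by (auto simp: e_def fun_eq_iff dest: spec[of _ i])
  have coeff: "mfps_nth (g k $ i) (e l) = (if k = l then 1 else 0)" for k l
    by (auto simp: g_def mfps_monom.rep_eq e_eq)
  have "inj g"
    by (rule injI) (metis coeff zero_neq_one)
  \<comment> \<open>Weights are additive, so adding multiples of \<open>m\<close> keeps the
    resonance of \<open>x_i\<close> with component \<open>i\<close>.\<close>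
  have "weight D (e k) = of_nat k * weight D m + weight D (unit_index i)" for k
    by (simp add: weight_def e_def algebra_simps sum.distrib sum_distrib_left)
  moreover have "weight D (unit_index i) = D $ i $ i"
    by (simp add: weight_def unit_index_def if_distrib[of of_nat] if_distrib[of "\<lambda>x. x * _"] cong: if_cong)
  ultimately have cent: "range g \<subseteq> centralizer_for (linear_vf D)"
    using monomial_vf_in_centralizer[OF D] by (auto simp: g_def 0)
  have "vf.independent (range g)"
    unfolding vf.dependent_def
  proof clarify
    fix k
    assume "g k \<in> vf.span (range g - {g k})"
    \<comment> \<open>The coefficient at \<open>e k\<close> in component \<open>i\<close> is a
      linear functional vanishing on every other \<open>g l\<close> but equal to 1 on
      \<open>g k\<close>.\<close>
    moreover have "vf.span (range g - {g k}) \<subseteq> {v. mfps_nth (v $ i) (e k) = 0}"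
    proof (rule vf.span_minimal)
      show "range g - {g k} \<subseteq> {v. mfps_nth (v $ i) (e k) = 0}"
        by (auto simp: coeff)
      show "vf.subspace {v. mfps_nth (v $ i) (e k) = 0}"
        by (auto simp: vf.subspace_def vf_scale_def mfps_nth_const_mult)
    qed
    ultimately show False
      using coeff[of k k] by auto
  qed
  moreover obtain B where "finite B" "centralizer_for (linear_vf D) = vf.span B"
    using fin by (auto simp: vf_finite_dim_def)
  ultimately have "finite (range g)"
    using vf.independent_span_bound cent by blast
  then show False
    using \<open>inj g\<close> finite_imageD infinite_UNIV_nat by blast
qed


section \<open>The filtration by order\<close>

text \<open>The \<open>d\<close>-th power of the maximal ideal, given by vanishing coefficients; the
  zero series lies in every level.\<close>

definition order_ge :: "nat \<Rightarrow> 'n::finite mfps \<Rightarrow> bool" where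
  "order_ge d p \<longleftrightarrow> (\<forall>m. sum m UNIV < d \<longrightarrow> mfps_nth p m = 0)"

lemma order_ge_add: "order_ge d p \<Longrightarrow> order_ge d q \<Longrightarrow> order_ge d (p + q)"
  and order_ge_diff: "order_ge d p \<Longrightarrow> order_ge d q \<Longrightarrow> order_ge d (p - q)"
  and order_ge_sum: "(\<And>x. x \<in> S \<Longrightarrow> order_ge d (r x)) \<Longrightarrow> order_ge d (sum r S)"
  by (auto simp: order_ge_def)

lemma order_ge_mono: "order_ge d p \<Longrightarrow> c \<le> d \<Longrightarrow> order_ge c p"
  by (auto simp: order_ge_def)

lemma order_ge_const_mult: "order_ge d p \<Longrightarrow> order_ge d (mfps_const c * p)"
  by (auto simp: order_ge_def mfps_nth_const_mult)

lemma order_ge_mult: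
  fixes p q :: "'n::finite mfps"
  assumes p: "order_ge c p" and q: "order_ge d q"
  shows "order_ge (c + d) (p * q)"
  unfolding order_ge_def mfps_nth_mult
proof (intro allI impI sum.neutral ballI)
  fix m a :: "'n \<Rightarrow> nat"
  assume m: "sum m UNIV < c + d" and a: "a \<in> {a. a \<le> m}"
  then have "sum (\<lambda>i. m i - a i) UNIV = sum m UNIV - sum a UNIV" "sum a UNIV \<le> sum m UNIV"
    by (auto simp: le_fun_def intro!: sum_subtractf_nat sum_mono)
  with m have "sum a UNIV < c \<or> sum (\<lambda>i. m i - a i) UNIV < d"
    by linarith
  then show "mfps_nth p a * mfps_nth q (\<lambda>i. m i - a i) = 0"
    using p q by (auto simp: order_ge_def)
qed

lemma sum_multiindex_Suc: "sum (m(i := m i + 1 :: nat)) UNIV = Suc (sum m (UNIV :: 'n::finite set))"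
  by (simp add: sum.remove[of UNIV i])

lemma order_ge_deriv: "order_ge (Suc d) p \<Longrightarrow> order_ge d (mfps_deriv i p)"
  using sum_multiindex_Suc[of _ i] by (auto simp: order_ge_def mfps_nth_deriv)

text \<open>Differentiation loses one order and multiplication by \<open>g $ j\<close> gains
  \<open>Suc c\<close>. Thus \<open>c = 0\<close> preserves the filtration and \<open>c = 1\<close>
  raises it.\<close>

lemma order_ge_lie_derivative:
  assumes "order_ge d p" and "\<And>i. order_ge (Suc c) (g $ i)"
  shows "order_ge (c + d) (lie_derivative g p)"
proof (cases d)
  \<comment> \<open>At order 0 differentiation cannot lose anything, so the bound is even better
    than required.\<close>
  case 0
  show ?thesis
    unfolding lie_derivative_def
  proof (rule order_ge_sum)
    fix j
    have "order_ge (0 + Suc c) (mfps_deriv j p * g $ j)"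
      using assms(2) by (intro order_ge_mult) (auto simp: order_ge_def)
    then show "order_ge (c + d) (mfps_deriv j p * g $ j)"
      using 0 by (auto intro: order_ge_mono)
  qed
next
  case (Suc b)
  show ?thesis
    unfolding lie_derivative_def
  proof (rule order_ge_sum)
    fix j
    have "order_ge (b + Suc c) (mfps_deriv j p * g $ j)"
      using assms Suc by (intro order_ge_mult) (auto intro: order_ge_deriv)
    then show "order_ge (c + d) (mfps_deriv j p * g $ j)"
      using Suc by (simp add: add.commute)
  qed
qed

text \<open>Successive approximation: cancel the lowest degree of the defect, repeat, and sum the
  corrections, whose orders tend to infinity.\<close>

lemma surjective_from_graded:
  fixes T :: "'n::finite mfps \<Rightarrow> 'n mfps"
  assumes diff: "\<And>p q. T (p - q) = T p - T q"
    and T: "\<And>d p. order_ge d p \<Longrightarrow> order_ge d (T p)"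
    and solve: "\<And>d p. order_ge (Suc d) p \<Longrightarrow> \<exists>w. order_ge (Suc d) w \<and> order_ge (Suc (Suc d)) (p - T w)"
    and q: "order_ge (Suc 0) q"
  shows "\<exists>p. T p = q"
proof -
  obtain W where W: "order_ge (Suc d) (W d p)" "order_ge (Suc (Suc d)) (p - T (W d p))"
    if "order_ge (Suc d) p" for d p
    using solve by metis
  \<comment> \<open>\<open>v d\<close> is the defect left after \<open>d\<close>
    corrections.\<close>
  define v where "v = rec_nat q (\<lambda>d p. p - T (W d p))"
  have v: "order_ge (Suc d) (v d)" for d
    by (induction d) (auto simp: v_def q W)
  define w where "w d = W d (v d)" for d
  have w: "order_ge (Suc d) (w d)" for d
    using W v by (simp add: w_def)
  have T0: "T 0 = 0"
    using diff[of 0 0] by simp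
  then have neg: "T (- p) = - T p" for p
    using diff[of 0 p] by simp
  have v_eq: "v d = q - T (\<Sum>k<d. w k)" for d
  proof (induction d)
    case 0
    then show ?case by (simp add: v_def T0)
  next
    case (Suc d)
    have "v (Suc d) = v d - T (w d)"
      by (simp add: v_def w_def)
    with Suc show ?case
      using diff[of "\<Sum>k<d. w k" "- w d"] by (simp add: neg)
  qed
  \<comment> \<open>The infinite sum of all \<open>w k\<close>, cut off coefficientwise:
    \<open>w k\<close> has order at least \<open>k + 1\<close>, so only
    \<open>k < sum m UNIV\<close> contributes at \<open>m\<close>.\<close>
  define p where "p = Abs_mfps (\<lambda>m. \<Sum>k<sum m UNIV. mfps_nth (w k) m)"
  have p_nth: "mfps_nth p m = (\<Sum>k<sum m UNIV. mfps_nth (w k) m)" for m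
    by (simp add: p_def Abs_mfps_inverse)
  have p: "order_ge (Suc d) (p - (\<Sum>k<d. w k))" for d
    unfolding order_ge_def
  proof (intro allI impI)
    fix m :: "'n \<Rightarrow> nat"
    assume m: "sum m UNIV < Suc d"
    have "(\<Sum>k<d. mfps_nth (w k) m) = (\<Sum>k<sum m UNIV. mfps_nth (w k) m)"
      using m w by (intro sum.mono_neutral_right) (auto simp: order_ge_def)
    then show "mfps_nth (p - (\<Sum>k<d. w k)) m = 0"
      by (simp add: p_nth)
  qed
  \<comment> \<open>The difference is \<open>v d\<close> minus \<open>T\<close> of the tail of the
    sum, both of order at least \<open>Suc d\<close>.\<close>
  have "order_ge (Suc d) (q - T p)" for d
    using order_ge_diff[OF v[of d] T[OF p[of d]]] by (simp add: v_eq diff)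
  then have "q - T p = 0"
    by (intro mfps_eqI) (auto simp: order_ge_def)
  then show ?thesis by auto
qed


section \<open>Inverting the derivation along a linear field\<close>

lemma matrix_power_vector: "(((*v) N) ^^ k) v = ((((**) N) ^^ k) (mat 1)) *v v"
  for N :: "complex ^ 'n ^ 'n::finite"
  by (induction k) (auto simp: matrix_vector_mul_assoc)

text \<open>Reconciles the left powers in \<open>nilpotent\<close> with the right multiplication in
  \<open>lie_derivative_linear_vf_nth\<close>.\<close>

lemma matrix_power_right: "((\<lambda>B. B ** N) ^^ k) (mat 1) = (((**) N) ^^ k) (mat 1)"
  for N :: "complex ^ 'n ^ 'n::finite"
proof (induction k)
  case (Suc k)
  have "(((**) N) ^^ k) (mat 1) ** N = N ** (((**) N) ^^ k) (mat 1)"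
    by (induction k) (auto simp: matrix_mul_assoc[symmetric])
  with Suc show ?case by simp
qed simp

text \<open>After \<open>a + b\<close> applications of the Leibniz rule, each term differentiates
  \<open>p\<close> at least \<open>a\<close> times or \<open>q\<close> at least \<open>b\<close>
  times. Induction on \<open>a + b\<close> avoids the binomial formula.\<close>

lemma locally_nilpotent_mult:
  assumes "((lie_derivative g) ^^ a) p = 0" and "((lie_derivative g) ^^ b) q = 0"
  shows "((lie_derivative g) ^^ (a + b)) (p * q) = 0"
  using assms
proof (induction "a + b" arbitrary: a b p q)
  case (Suc n)
  have zero: "(lie_derivative g ^^ k) 0 = 0" for k
    by (induction k) auto
  show ?case
  proof (cases "a = 0 \<or> b = 0")
    \<comment> \<open>A zeroth iterate that vanishes means that the factor itself is zero.\<close>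
    case True
    then show ?thesis using Suc.prems by (auto simp: zero)
  next
    case False
    then obtain a' b' where ab: "a = Suc a'" "b = Suc b'"
      by (metis not0_implies_Suc)
    have add: "(lie_derivative g ^^ k) (r + s) = (lie_derivative g ^^ k) r + (lie_derivative g ^^ k) s"
      for k r s
      by (induction k) (auto simp: lie_derivative_add)
    have "(lie_derivative g ^^ (a' + b)) (lie_derivative g p * q) = 0"
      using Suc ab by (intro Suc.hyps(1)) (auto simp: funpow_Suc_right simp del: funpow.simps)
    moreover have "(lie_derivative g ^^ (a + b')) (p * lie_derivative g q) = 0"
      using Suc ab by (intro Suc.hyps(1)) (auto simp: funpow_Suc_right simp del: funpow.simps)
    moreover have "a + b = Suc n" "a' + b = n" "a + b' = n"
      using Suc.hyps(2) ab by auto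
    ultimately show ?thesis
      by (simp only: funpow_Suc_right o_apply lie_derivative_mult add) simp
  qed
qed auto

text \<open>Splits off one variable at a time. A variable is a linear form, hence killed once the
  power of \<open>N\<close> vanishes.\<close>

lemma monom_locally_nilpotent:
  fixes N :: "complex ^ 'n ^ 'n::finite"
  assumes "nilpotent N"
  shows "\<exists>k. (lie_derivative (linear_vf N) ^^ k) (mfps_monom m) = 0"
proof (induction "sum m UNIV" arbitrary: m)
  case 0
  then have "mfps_monom m = (mfps_const 1 :: 'n mfps)"
    by (intro mfps_eqI) (auto simp: mfps_monom.rep_eq mfps_const.rep_eq)
  then have "(lie_derivative (linear_vf N) ^^ 1) (mfps_monom m) = 0"
    by simp
  then show ?case ..
next
  case (Suc d)
  then obtain i where i: "m i \<noteq> 0"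
    by (metis sum.neutral nat.distinct(1))
  let ?m = "m(i := m i - 1)"
  have m: "?m(i := ?m i + 1) = m"
    using i by auto
  have "sum ?m UNIV = d"
    using Suc.hyps(2) sum_multiindex_Suc[of ?m i] unfolding m by simp
  then obtain a where a: "(lie_derivative (linear_vf N) ^^ a) (mfps_monom ?m) = 0"
    using Suc.hyps(1) by blast
  obtain b where b: "(((**) N) ^^ b) (mat 1) = 0"
    using assms by (auto simp: nilpotent_def)
  \<comment> \<open>As a component of the identity field, the variable has iterated derivatives
    given by right powers of \<open>N\<close>.\<close>
  have "mfps_X i = linear_vf (mat 1) $ i"
  proof -
    have "linear_vf (mat 1) $ i = (\<Sum>j\<in>UNIV. if j = i then mfps_X i else 0)"
      unfolding linear_vf_nth
      by (rule sum.cong) (auto simp: mat_def mfps_const_1 intro!: mfps_eqI simp: mfps_nth_const_mult)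
    then show ?thesis by simp
  qed
  moreover have "(lie_derivative (linear_vf N) ^^ k) (linear_vf (mat 1) $ i) =
      linear_vf (((\<lambda>B. B ** N) ^^ k) (mat 1)) $ i" for k
    by (induction k) (auto simp: lie_derivative_linear_vf_nth)
  moreover have "linear_vf (0 :: complex ^ 'n ^ 'n) = 0"
    using linear_vf_add[of 0 "0 :: complex ^ 'n ^ 'n"] by simp
  ultimately have "(lie_derivative (linear_vf N) ^^ b) (mfps_X i) = 0"
    by (simp add: matrix_power_right b)
  from locally_nilpotent_mult[OF this a]
  have "(lie_derivative (linear_vf N) ^^ (b + a)) (mfps_X i * mfps_monom ?m) = 0" .
  moreover have "mfps_X i * mfps_monom ?m = mfps_monom m"
  proof (rule mfps_eqI)
    fix k
    show "mfps_nth (mfps_X i * mfps_monom ?m) k = mfps_nth (mfps_monom m) k"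
      using i by (auto simp: mfps_nth_X_mult mfps_monom.rep_eq)
        (metis One_nat_def Suc_pred fun_upd_same fun_upd_triv fun_upd_upd not_gr_zero)
  qed
  ultimately show ?case by auto
qed

text \<open>Compare the entries at \<open>(j, k)\<close>: \<open>N\<close> couples only coordinates
  with equal eigenvalues of \<open>D\<close>.\<close>

lemma commute_diagonal_entry:
  fixes D N :: "complex ^ 'n ^ 'n::finite"
  assumes D: "diagonal D" and DN: "D ** N = N ** D" and N: "N $ j $ k \<noteq> 0"
  shows "D $ j $ j = D $ k $ k"
proof -
  have "(D ** N) $ j $ k = (\<Sum>l\<in>UNIV. if l = j then D $ j $ j * N $ j $ k else 0)"
    unfolding matrix_matrix_mult_def vec_lambda_beta using D
    by (intro sum.cong) (auto simp: diagonal_def)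
  moreover have "(N ** D) $ j $ k = (\<Sum>l\<in>UNIV. if l = k then N $ j $ k * D $ k $ k else 0)"
    unfolding matrix_matrix_mult_def vec_lambda_beta using D
    by (intro sum.cong) (auto simp: diagonal_def)
  ultimately show ?thesis
    using DN N by simp
qed

section \<open>Solving the derivation equation for linear part \<open>D + N\<close>\<close>

context
  fixes D N :: "complex ^ 'n ^ 'n::finite"
  assumes D: "diagonal D" and DN: "D ** N = N ** D" and nil: "nilpotent N"
    and weight: "\<And>m. m \<noteq> (\<lambda>_. 0) \<Longrightarrow> weight D m \<noteq> 0"
begin

text \<open>The field \<open>N\<close> preserves weights, so its derivation commutes with dividing by them.\<close>

lemma lie_derivative_commute_weight:
  assumes q: "\<And>m. mfps_nth q m = mfps_nth p m / weight D m"
  shows "mfps_nth (lie_derivative (linear_vf N) q) m =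
    mfps_nth (lie_derivative (linear_vf N) p) m / weight D m"
proof -
  have "N $ j $ k * mfps_nth (mfps_deriv j q) (m(k := m k - 1)) =
      N $ j $ k * mfps_nth (mfps_deriv j p) (m(k := m k - 1)) / weight D m"
    if "m k \<noteq> 0" for j k
  proof (cases "N $ j $ k = 0")
    case False
    let ?u = "m(k := m k - 1)"
    have plus: "weight D (u(i := u i + 1)) = weight D u + D $ i $ i" for u i
      by (simp add: weight_def sum.remove[of UNIV i] algebra_simps)
    have "?u(k := ?u k + 1) = m"
      using that by auto
    \<comment> \<open>Replacing \<open>x_k\<close> by \<open>x_j\<close> changes the weight by
      \<open>D $ j $ j - D $ k $ k\<close>, which is zero since \<open>N $ j $ k\<close> is
      not.\<close>
    then have "weight D (?u(j := ?u j + 1)) = weight D m"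
      using plus[of ?u j] plus[of ?u k] commute_diagonal_entry[OF D DN False] by simp
    then show ?thesis
      by (simp add: mfps_nth_deriv q)
  qed auto
  then show ?thesis
    by (auto simp: lie_derivative_linear_vf_coeff sum_divide_distrib intro!: sum.cong)
qed

text \<open>A finite Neumann series. If \<open>E\<close> inverts the derivation along
  \<open>D\<close>, then \<open>E p\<close> solves the equation up to \<open>E (?M p)\<close>, which
  one iterate fewer annihilates.\<close>

lemma lie_derivative_solve_nilpotent:
  assumes "(lie_derivative (linear_vf N) ^^ k) p = 0" and "order_ge (Suc d) p"
  shows "\<exists>w. order_ge (Suc d) w \<and> lie_derivative (linear_vf (D + N)) w = p"
  using assms
proof (induction k arbitrary: p)
  case 0
  then show ?case
    by (auto intro!: exI[of _ 0] simp: order_ge_def)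
next
  case (Suc k)
  let ?M = "lie_derivative (linear_vf N)"
  \<comment> \<open>At the zero exponent the weight is 0 and division yields 0; this is harmless
    because \<open>p\<close> has no constant term.\<close>
  define E where "E r = Abs_mfps (\<lambda>m. mfps_nth r m / weight D m)" for r :: "'n mfps"
  have E: "mfps_nth (E r) m = mfps_nth r m / weight D m" for r m
    by (simp add: E_def Abs_mfps_inverse)
  have ME: "?M (E r) = E (?M r)" for r
    by (rule mfps_eqI) (simp add: E lie_derivative_commute_weight[OF E])
  have pow: "(?M ^^ l) (E r) = E ((?M ^^ l) r)" for l r
    by (induction l) (auto simp: ME)
  have neg: "(?M ^^ l) (- r) = - (?M ^^ l) r" for l r
    by (induction l) (auto simp: lie_derivative_minus)
  have "order_ge (Suc 0) (linear_vf N $ i)" for i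
    by (auto simp: order_ge_def linear_vf_nth mfps_nth_const_mult mfps_nth_X unit_index_def fun_eq_iff)
  then have ord: "order_ge (Suc d) (?M p)"
    using order_ge_lie_derivative[OF Suc.prems(2), of 0] by simp
  have "E 0 = 0"
    by (rule mfps_eqI) (simp add: E)
  \<comment> \<open>\<open>E\<close> commutes with \<open>?M\<close>, so this is \<open>- E\<close>
    applied to the vanishing iterate of order \<open>Suc k\<close>.\<close>
  then have "(?M ^^ k) (- E (?M p)) = 0"
    using Suc.prems(1) by (simp add: neg pow funpow_Suc_right del: funpow.simps)
  moreover have "order_ge (Suc d) (- E (?M p))"
    using ord by (auto simp: order_ge_def E)
  ultimately obtain w where w: "order_ge (Suc d) w"
    "lie_derivative (linear_vf (D + N)) w = - E (?M p)"
    using Suc.IH by blast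
  have "order_ge (Suc d) (E p)"
    using Suc.prems(2) by (auto simp: order_ge_def E)
  moreover have "lie_derivative (linear_vf D) (E p) = p"
  proof (rule mfps_eqI)
    fix m :: "'n \<Rightarrow> nat"
    show "mfps_nth (lie_derivative (linear_vf D) (E p)) m = mfps_nth p m"
      using Suc.prems(2) weight[of m]
      by (cases "m = (\<lambda>_. 0)") (auto simp: lie_derivative_diagonal[OF D] E order_ge_def)
  qed
  ultimately have "order_ge (Suc d) (E p + w) \<and> lie_derivative (linear_vf (D + N)) (E p + w) = p"
    using w by (auto simp: order_ge_add lie_derivative_add linear_vf_add lie_derivative_vf_add ME)
  then show ?case ..
qed

text \<open>To leading order only the linear part of \<open>f\<close> acts, so its solvability in
  each degree lifts by successive approximation.\<close>

lemma lie_derivative_surjective: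
  assumes f: "has_linear_part f (D + N)" and q: "mfps_nth q (\<lambda>_. 0) = 0"
  shows "\<exists>p. lie_derivative f p = q"
proof (rule surjective_from_graded[where T = "lie_derivative f"])
  have sum_eq_0: "m = (\<lambda>_. 0)" if "sum m UNIV = 0" for m :: "'n \<Rightarrow> nat"
    using that by auto
  show "lie_derivative f (r - s) = lie_derivative f r - lie_derivative f s" for r s
    by (rule lie_derivative_diff)
  have f1: "order_ge (Suc 0) (f $ i)" for i
    using f sum_eq_0 by (auto simp: order_ge_def has_linear_part_def)
  show "order_ge d (lie_derivative f r)" if "order_ge d r" for d r
    using order_ge_lie_derivative[OF that, of 0 f] f1 by simp
  show "order_ge (Suc 0) q"
    using q sum_eq_0 by (auto simp: order_ge_def)
  define A where "A = D + N"
  have f2: "order_ge (Suc (Suc 0)) ((f - linear_vf A) $ i)" for i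
    unfolding order_ge_def
  proof (intro allI impI)
    fix m :: "'n \<Rightarrow> nat"
    assume "sum m UNIV < Suc (Suc 0)"
    then consider "sum m UNIV = 0" | "sum m UNIV = 1"
      by linarith
    then show "mfps_nth ((f - linear_vf A) $ i) m = 0"
    proof cases
      case 1
      then have m: "m = (\<lambda>_. 0)" by (rule sum_eq_0)
      have "(\<lambda>_. 0) \<noteq> unit_index j" for j :: 'n
        by (auto simp: unit_index_def fun_eq_iff)
      then show ?thesis
        using f by (simp add: m has_linear_part_def linear_vf_nth mfps_nth_const_mult mfps_nth_X)
    next
      case 2
      then obtain j where "m j = 1" "\<forall>k. k \<noteq> j \<longrightarrow> m k = 0"
        using sum_eq_1_iff[of UNIV m] by auto
      then have m: "m = unit_index j"
        by (auto simp: unit_index_def)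
      have "unit_index j = unit_index k \<longleftrightarrow> k = j" for k :: 'n
        by (auto simp: unit_index_def fun_eq_iff split: if_splits)
      then show ?thesis
        using f by (simp add: has_linear_part_def linear_vf_nth mfps_nth_const_mult mfps_nth_X m A_def
            if_distrib[of "\<lambda>x. _ * x"] cong: if_cong)
    qed
  qed
  show "\<exists>w. order_ge (Suc d) w \<and> order_ge (Suc (Suc d)) (r - lie_derivative f w)"
    if r: "order_ge (Suc d) r" for d r
  proof -
    let ?S = "{m :: 'n \<Rightarrow> nat. sum m UNIV = Suc d}"
    have "m i \<le> sum m UNIV" for m :: "'n \<Rightarrow> nat" and i
      by (rule member_le_sum) auto
    then have "?S \<subseteq> {m. m \<le> (\<lambda>_. Suc d)}"
      by (auto simp: le_fun_def) metis
    then have fin: "finite ?S"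
      using finite_multiindex_le finite_subset by blast
    \<comment> \<open>Monomials are treated singly, since the number of iterates killing one may
      depend on it.\<close>
    have "\<exists>w. order_ge (Suc d) w \<and> lie_derivative (linear_vf A) w = mfps_monom m" if "m \<in> ?S" for m
      using monom_locally_nilpotent[OF nil, of m] that lie_derivative_solve_nilpotent[of _ "mfps_monom m" d]
      by (auto simp: order_ge_def mfps_monom.rep_eq A_def)
    then obtain W where W: "order_ge (Suc d) (W m)" "lie_derivative (linear_vf A) (W m) = mfps_monom m"
      if "m \<in> ?S" for m
      by metis
    \<comment> \<open>By linearity this hits exactly the degree \<open>Suc d\<close> part of
      \<open>r\<close>.\<close>
    define w where "w = (\<Sum>m\<in>?S. mfps_const (mfps_nth r m) * W m)"
    have w: "order_ge (Suc d) w"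
      unfolding w_def by (intro order_ge_sum order_ge_const_mult W)
    have "lie_derivative (linear_vf A) w = (\<Sum>m\<in>?S. mfps_const (mfps_nth r m) * mfps_monom m)"
      by (simp add: w_def lie_derivative_sum lie_derivative_mult W)
    then have "mfps_nth (lie_derivative (linear_vf A) w) m =
        (\<Sum>a\<in>?S. if m = a then mfps_nth r m else 0)" for m
      by (auto simp: mfps_nth_const_mult mfps_monom.rep_eq intro!: sum.cong)
    then have "mfps_nth (lie_derivative (linear_vf A) w) m =
        (if m \<in> ?S then mfps_nth r m else 0)" for m
      using fin by simp
    then have "order_ge (Suc (Suc d)) (r - lie_derivative (linear_vf A) w)"
      using r by (auto simp: order_ge_def less_Suc_eq)
    \<comment> \<open>The remainder of \<open>f\<close> starts in degree 2, so its derivation raises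
      the order by one.\<close>
    moreover have "order_ge (Suc (Suc d)) (lie_derivative (f - linear_vf A) w)"
      using order_ge_lie_derivative[OF w f2] by simp
    ultimately have "order_ge (Suc (Suc d))
        (r - lie_derivative (linear_vf A) w - lie_derivative (f - linear_vf A) w)"
      by (rule order_ge_diff)
    then show ?thesis
      using w by (auto simp: lie_derivative_vf_diff)
  qed
qed

text \<open>The kernel of \<open>D + N\<close> is stable under \<open>N\<close>. If \<open>N\<close>
  kills a kernel vector, so does \<open>D\<close>, which is injective; descending along the powers
  of \<open>N\<close> shows that the kernel is trivial.\<close>

lemma invertible_linear_part: "invertible (D + N)"
proof -
  have Dv: "v = 0" if "D *v v = 0" for v
  proof -
    have "v $ i = 0" for i
    proof -
      \<comment> \<open>The eigenvalues of \<open>D\<close> are the weights of the exponents of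
        degree one.\<close>
      have "weight D (unit_index i) \<noteq> 0"
        by (rule weight) (auto simp: unit_index_def fun_eq_iff)
      moreover have "weight D (unit_index i) = D $ i $ i"
        by (simp add: weight_def unit_index_def if_distrib[of of_nat] if_distrib[of "\<lambda>x. x * _"] cong: if_cong)
      moreover have "(D *v v) $ i = (\<Sum>j\<in>UNIV. if j = i then D $ i $ i * v $ i else 0)"
        unfolding matrix_vector_mult_def vec_lambda_beta using D
        by (intro sum.cong) (auto simp: diagonal_def)
      ultimately show ?thesis
        using that by simp
    qed
    then show ?thesis by (simp add: vec_eq_iff)
  qed
  have "v = 0" if v: "(D + N) *v v = 0" for v
  proof -
    obtain k where "(((**) N) ^^ k) (mat 1) = 0"
      using nil by (auto simp: nilpotent_def)
    then have "(((*v) N) ^^ k) v = 0"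
      by (simp add: matrix_power_vector)
    then show ?thesis
    proof (induction k)
      case (Suc k)
      let ?u = "(((*v) N) ^^ k) v"
      have "(D + N) *v ?u = 0"
      proof (induction k)
        case (Suc k)
        have "(D + N) ** N = N ** (D + N)"
          using DN by (simp add: matrix_matrix_mult_def vec_eq_iff algebra_simps sum.distrib)
        then show ?case
          using Suc by (simp add: matrix_vector_mul_assoc) (simp flip: matrix_vector_mul_assoc)
      qed (simp add: v)
      then have "D *v ?u = 0"
        using Suc.prems by (simp add: matrix_vector_mult_add_rdistrib)
      then show ?case
        using Dv Suc.IH by blast
    qed simp
  qed
  then show ?thesis
    by (simp add: invertible_left_inverse matrix_left_invertible_ker)
qed

end

section \<open>The trace argument and the splitting of the normalizer\<close>

text \<open>With \<open>C\<close> the inverse of \<open>A\<close>, the trace of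
  \<open>C ** (A ** B - B ** A)\<close> vanishes by cyclicity, yet equals \<open>c\<close> times the
  dimension.\<close>

lemma commutator_eq_scalar_multiple:
  fixes A B :: "complex ^ 'n ^ 'n::finite"
  assumes A: "invertible A" and eq: "\<And>i j. (A ** B - B ** A) $ i $ j = c * A $ i $ j"
  shows "c = 0"
proof -
  obtain C where C: "C ** A = mat 1"
    using A by (auto simp: invertible_left_inverse)
  then have C': "A ** C = mat 1"
    using matrix_left_right_inverse by blast
  have "C ** (X - Y) = C ** X - C ** Y" for X Y :: "complex ^ 'n ^ 'n"
    by (simp add: matrix_matrix_mult_def vec_eq_iff right_diff_distrib sum_subtractf)
  then have "trace (C ** (A ** B - B ** A)) = trace (C ** (A ** B)) - trace (C ** (B ** A))"
    by (simp add: trace_sub)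
  also have "trace (C ** (B ** A)) = trace (B ** (A ** C))"
    by (metis matrix_mul_assoc trace_mul_sym)
  also have "C ** (A ** B) = B"
    by (simp add: matrix_mul_assoc C)
  finally have "trace (C ** (A ** B - B ** A)) = 0"
    by (simp add: C')
  moreover have "(C ** (A ** B - B ** A)) $ i $ j = c * (C ** A) $ i $ j" for i j
    unfolding matrix_matrix_mult_def[of C] by (simp only: vec_lambda_beta eq sum_distrib_left mult_ac)
  then have "trace (C ** (A ** B - B ** A)) = c * trace (C ** A)"
    by (simp only: trace_def sum_distrib_left)
  moreover have "trace (C ** A) = of_nat CARD('n)"
    by (simp add: C trace_def mat_def)
  ultimately show ?thesis by simp
qed

theorem proposition5:
  fixes As A :: "complex ^ 'n ^ 'n::finite" and f :: "'n vfield"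
  assumes "diagonal As"
    and "vf_finite_dim (centralizer_for (linear_vf As))"
    and "has_linear_part f A"
    and "is_semisimple_part A As"
    and "poincare_dulac_normal_form f"
  shows "normalizer_for f = centralizer_for f + {\<beta> *s f | \<beta>. True}"
proof (intro equalityI subsetI)
  fix g
  assume "g \<in> centralizer_for f + {\<beta> *s f | \<beta>. True}"
  then obtain h b where g: "g = h + b *s f" and h: "lie_bracket h f = 0"
    by (auto simp: set_plus_def centralizer_for_def)
  have "lie_bracket g f = - lie_derivative f b *s f"
    by (simp add: g lie_bracket_add h lie_bracket_scale_self)
  then show "g \<in> normalizer_for f"
    unfolding normalizer_for_def by blast
next
  obtain N where A: "A = As + N" and nil: "nilpotent N" and comm: "As ** N = N ** As"
    using assms(4) by (auto simp: is_semisimple_part_def)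
  \<comment> \<open>\<open>weight_nonzero\<close> converts finite dimension into the nonvanishing of
    weights assumed by the context above.\<close>
  note linear = assms(1) comm nil weight_nonzero[OF assms(1,2)]
  have inv: "invertible A"
    unfolding A by (rule invertible_linear_part[OF linear])
  have f0: "mfps_nth (f $ i) (\<lambda>_. 0) = 0" and f1: "mfps_nth (f $ i) (unit_index j) = A $ i $ j" for i j
    using assms(3) by (auto simp: has_linear_part_def)
  fix g
  assume "g \<in> normalizer_for f"
  then obtain \<mu> where \<mu>: "lie_bracket g f = \<mu> *s f"
    by (auto simp: normalizer_for_def)
  then have bracket: "lie_derivative g (f $ i) - lie_derivative f (g $ i) = \<mu> * f $ i" for i
    by (metis lie_bracket_nth vector_smult_component)
  define B where "B = (\<chi> i j. mfps_nth (g $ i) (unit_index j))"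
  have deriv0: "mfps_nth (mfps_deriv j p) (\<lambda>_. 0) = mfps_nth p (unit_index j)" for j and p :: "'n mfps"
  proof -
    have "(\<lambda>_. 0)(j := Suc 0) = unit_index j"
      by (auto simp: unit_index_def)
    then show ?thesis
      by (simp add: mfps_nth_deriv)
  qed
  \<comment> \<open>Constant terms of the bracket equation: all terms containing \<open>f\<close>
    undifferentiated vanish at the origin.\<close>
  have "A *v (\<chi> i. mfps_nth (g $ i) (\<lambda>_. 0)) = 0"
  proof -
    have "(\<Sum>j\<in>UNIV. A $ i $ j * mfps_nth (g $ j) (\<lambda>_. 0)) = 0" for i
      using arg_cong[OF bracket[of i], of "\<lambda>p. mfps_nth p (\<lambda>_. 0)"]
      by (simp add: lie_derivative_def mfps_nth_mult_0 f0 deriv0 f1)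
    then show ?thesis
      by (simp add: vec_eq_iff matrix_vector_mult_def)
  qed
  then have "(\<chi> i. mfps_nth (g $ i) (\<lambda>_. 0)) = 0"
    using inv by (metis invertible_left_inverse matrix_left_invertible_ker)
  then have g0: "mfps_nth (g $ i) (\<lambda>_. 0) = 0" for i
    by (simp add: vec_eq_iff)
  \<comment> \<open>In degree one the second-order coefficients of \<open>f\<close> and
    \<open>g\<close> drop out, being multiplied by constant terms of \<open>g\<close> and
    \<open>f\<close>.\<close>
  have "(A ** B - B ** A) $ i $ k = mfps_nth \<mu> (\<lambda>_. 0) * A $ i $ k" for i k
    using arg_cong[OF bracket[of i], of "\<lambda>p. mfps_nth p (unit_index k)"]
    by (simp add: lie_derivative_def mfps_nth_mult_unit_index f0 f1 g0 deriv0 B_def matrix_matrix_mult_def)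
  then have "mfps_nth \<mu> (\<lambda>_. 0) = 0"
    using commutator_eq_scalar_multiple[OF inv] by blast
  then obtain b where b: "lie_derivative f b = - \<mu>"
    using lie_derivative_surjective[OF linear assms(3)[unfolded A], of "- \<mu>"] by auto
  have "lie_bracket (g - b *s f) f = 0"
    by (simp add: lie_bracket_diff \<mu> lie_bracket_scale_self b)
  then have "g - b *s f \<in> centralizer_for f"
    by (simp add: centralizer_for_def)
  then have "(g - b *s f) + b *s f \<in> centralizer_for f + {\<beta> *s f | \<beta>. True}"
    by (rule set_plus_intro) blast
  then show "g \<in> centralizer_for f + {\<beta> *s f | \<beta>. True}"
    by simp
qed

end
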